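(* The optimized two-step coarse propagator (O2CP), i.e. the linear two-step scheme determined by the rational functions $$R_1(s)=\frac{0.02178-0.00047\,s}{1+0.56380\,s},\qquad R_2(s)=\frac{0.97822-0.46300\,s}{1+0.56380\,s},$$ is A-stable and consistent.
   Context: A linear two-step scheme with real coefficients $\alpha_0,\alpha_1,\alpha_2,\beta_0,\beta_1,\beta_2$ and step size $\Delta T$, applied to the scalar test equation $y'+\lambda y=0$, reads $$\sum_{i=0}^2\alpha_iy_{n+i}=-\Delta T\,\lambda\sum_{i=0}^2\beta_iy_{n+i}.$$ The rational functions $R_1,R_2$ determine the coefficients through $$R_1(s)=\frac{-\alpha_0-\beta_0s}{\alpha_2+\beta_2s},\qquad R_2(s)=\frac{-\alpha_1-\beta_1s}{\alpha_2+\beta_2s},$$ normalized by $\alpha_2=1$. Thus for the O2CP: $\alpha_0=-0.02178$, $\alpha_1=-0.97822$, $\alpha_2=1$, $\beta_0=0.00047$, $\beta_1=0.46300$, $\beta_2=0.56380$ (exact decimals). Equivalently, $y_{n+2}=R_1(\mu)y_n+R_2(\mu)y_{n+1}$ with $\mu=\Delta T\,\lambda$. A-stable (with the sign convention $y'+\lambda y=0$): for every $\mu\in\mathbb C$ with $\Re\mu\ge0$, all roots $\zeta$ of $(\alpha_2+\beta_2\mu)\zeta^2+(\alpha_1+\beta_1\mu)\zeta+(\alpha_0+\beta_0\mu)=0$ satisfy $|\zeta|\le1$, and multiple roots satisfy $|\zeta|<1$. Consistent, in the paper's sense: $\alpha_0+\alpha_1+\alpha_2=0$ (no further order condition is required).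 *)

theory Defs
  imports Complex_Main "HOL-Computational_Algebra.Polynomial"
begin

record two_step_scheme =
  alpha0 :: real
  alpha1 :: real
  alpha2 :: real
  beta0 :: real
  beta1 :: real
  beta2 :: real

text \<open>
  The sequence \<open>y\<close> is produced by the scheme with step size \<open>dt\<close> for the test equation
  \<open>y' + lam y = 0\<close>. The parameter \<open>lam\<close> stands on the right-hand side with a minus sign,
  so decaying solutions correspond to the right half-plane.
\<close>

definition two_step_solution ::
    "two_step_scheme \<Rightarrow> real \<Rightarrow> complex \<Rightarrow> (nat \<Rightarrow> complex) \<Rightarrow> bool" where
  "two_step_solution S dt lam y \<longleftrightarrow>
     (\<forall>n. of_real (alpha0 S) * y n + of_real (alpha1 S) * y (n + 1) + of_real (alpha2 S) * y (n + 2)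
        = - of_real dt * lam *
          (of_real (beta0 S) * y n + of_real (beta1 S) * y (n + 1) + of_real (beta2 S) * y (n + 2)))"

definition R1 :: "two_step_scheme \<Rightarrow> complex \<Rightarrow> complex" where
  "R1 S s = (- of_real (alpha0 S) - of_real (beta0 S) * s) / (of_real (alpha2 S) + of_real (beta2 S) * s)"

definition R2 :: "two_step_scheme \<Rightarrow> complex \<Rightarrow> complex" where
  "R2 S s = (- of_real (alpha1 S) - of_real (beta1 S) * s) / (of_real (alpha2 S) + of_real (beta2 S) * s)"

lemma two_step_solution_iff_R:
  assumes "of_real (alpha2 S) + of_real (beta2 S) * (of_real dt * lam) \<noteq> 0"
  shows "two_step_solution S dt lam y \<longleftrightarrow>
    (\<forall>n. y (n + 2) = R1 S (of_real dt * lam) * y n + R2 S (of_real dt * lam) * y (n + 1))"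
proof -
  have "(a0 * u + a1 * v + a2 * w = - d * l * (b0 * u + b1 * v + b2 * w)) \<longleftrightarrow>
        (w = (- a0 - b0 * (d * l)) / (a2 + b2 * (d * l)) * u
           + (- a1 - b1 * (d * l)) / (a2 + b2 * (d * l)) * v)"
    if "a2 + b2 * (d * l) \<noteq> 0" for a0 a1 a2 b0 b1 b2 d l u v w :: complex
  proof -
    define D where "D = a2 + b2 * (d * l)"
    have D: "D \<noteq> 0" using that by (simp add: D_def)
    have "(a0 * u + a1 * v + a2 * w = - d * l * (b0 * u + b1 * v + b2 * w)) \<longleftrightarrow>
        w * D = (- a0 - b0 * (d * l)) * u + (- a1 - b1 * (d * l)) * v"
      unfolding D_def by algebra
    also have "\<dots> \<longleftrightarrow> w = (- a0 - b0 * (d * l)) / D * u + (- a1 - b1 * (d * l)) / D * v"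
      using D by (simp add: add_divide_distrib [symmetric] eq_divide_eq)
    finally show ?thesis by (simp only: D_def)
  qed
  from this [OF assms] show ?thesis
    by (simp only: two_step_solution_def R1_def R2_def)
qed

definition char_poly :: "two_step_scheme \<Rightarrow> complex \<Rightarrow> complex poly" where
  "char_poly S mu =
     [: of_real (alpha0 S) + of_real (beta0 S) * mu,
        of_real (alpha1 S) + of_real (beta1 S) * mu,
        of_real (alpha2 S) + of_real (beta2 S) * mu :]"

text \<open>
  Every number is a root of the zero polynomial, so a scheme whose \<open>char_poly\<close> vanishes for
  some \<open>mu\<close> in the closed right half-plane is not A-stable, whatever value \<open>order\<close> has there.
\<close>

definition A_stable :: "two_step_scheme \<Rightarrow> bool" where
  "A_stable S \<longleftrightarrow>
     (\<forall>mu. Re mu \<ge> 0 \<longrightarrow>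
        (\<forall>z. poly (char_poly S mu) z = 0 \<longrightarrow>
             cmod z \<le> 1 \<and> (order z (char_poly S mu) \<ge> 2 \<longrightarrow> cmod z < 1)))"

text \<open>Only the zeroth-order condition is imposed.\<close>

definition consistent :: "two_step_scheme \<Rightarrow> bool" where
  "consistent S \<longleftrightarrow> alpha0 S + alpha1 S + alpha2 S = 0"

definition O2CP :: two_step_scheme where
  "O2CP = \<lparr> alpha0 = - 0.02178, alpha1 = - 0.97822, alpha2 = 1,
             beta0 = 0.00047, beta1 = 0.46300, beta2 = 0.56380 \<rparr>"

text \<open>
  \<open>O2CP\<close> is the only scheme normalized by \<open>alpha2 = 1\<close> with its two rational functions.
  They are compared away from the poles, where division by zero would give the value 0.
\<close>

lemma O2CP_determined:
  "S = O2CP \<longleftrightarrow> alpha2 S = 1 \<and>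
     (\<forall>s. 1 + of_real (beta2 S) * s \<noteq> 0 \<longrightarrow> 1 + 0.56380 * s \<noteq> 0 \<longrightarrow>
        R1 S s = (0.02178 - 0.00047 * s) / (1 + 0.56380 * s) \<and>
        R2 S s = (0.97822 - 0.46300 * s) / (1 + 0.56380 * s))"
  (is "_ \<longleftrightarrow> ?rhs")
proof
  assume "S = O2CP"
  then show ?rhs by (simp add: O2CP_def R1_def R2_def)
next
  assume rhs: ?rhs
  then have a2: "alpha2 S = 1" by simp
  have key: "[:- a, - b:] * [:1, 0.56380:] = [:c, - d:] * [:1, beta2 S:]"
    if "\<And>s :: complex. 1 + of_real (beta2 S) * s \<noteq> 0 \<Longrightarrow> 1 + 0.56380 * s \<noteq> 0 \<Longrightarrow>
      (- of_real a - of_real b * s) / (1 + of_real (beta2 S) * s) =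
      (of_real c - of_real d * s) / (1 + 0.56380 * s)" for a b c d :: real
  proof (rule ccontr)
    let ?p = "[:- a, - b:] * [:1, 0.56380:]" and ?q = "[:c, - d:] * [:1, beta2 S:]"
    let ?r = "(?p - ?q) * [:1, beta2 S:] * [:1, 0.56380:]"
    assume "?p \<noteq> ?q"
    then have "?p - ?q \<noteq> 0" by (simp only: right_minus_eq not_False_eq_True)
    moreover have "[:1, x:] \<noteq> 0" for x :: real by simp
    ultimately have "?r \<noteq> 0" by (intro no_zero_divisors)
    then have "finite {x. poly ?r x = 0}" by (rule poly_roots_finite)
    moreover have "poly ?r x = 0" for x
    proof (cases "1 + beta2 S * x = 0 \<or> 1 + 0.56380 * x = 0")
      case True
      then have "poly [:1, beta2 S:] x = 0 \<or> poly [:1, 0.56380:] x = 0"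
        by (simp add: mult.commute)
      then show ?thesis unfolding poly_mult by auto
    next
      case False
      then have n: "1 + beta2 S * x \<noteq> 0" "1 + 0.56380 * x \<noteq> 0" by auto
      have c: "1 + of_real (beta2 S) * of_real x = (of_real (1 + beta2 S * x) :: complex)"
        "1 + 0.56380 * of_real x = (of_real (1 + 0.56380 * x) :: complex)"
        by simp_all
      have "(of_real ((- a - b * x) / (1 + beta2 S * x)) :: complex) =
            of_real ((c - d * x) / (1 + 0.56380 * x))"
        using that [of "of_real x"] n unfolding c of_real_eq_0_iff by simp
      then have "(- a - b * x) / (1 + beta2 S * x) = (c - d * x) / (1 + 0.56380 * x)"
        unfolding of_real_eq_iff .
      then have "(- a - b * x) * (1 + 0.56380 * x) = (c - d * x) * (1 + beta2 S * x)"
        by (rule iffD1 [OF frac_eq_eq [OF n]])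
      then have "poly ?p x = poly ?q x"
        unfolding poly_mult by (simp add: mult.commute)
      then show ?thesis unfolding poly_mult poly_diff by simp
    qed
    ultimately show False by (simp add: infinite_UNIV_char_0)
  qed
  have 1: "[:- alpha0 S, - beta0 S:] * [:1, 0.56380:] = [:0.02178, - 0.00047:] * [:1, beta2 S:]"
    using rhs a2 by (intro key) (auto simp: R1_def)
  have 2: "[:- alpha1 S, - beta1 S:] * [:1, 0.56380:] = [:0.97822, - 0.46300:] * [:1, beta2 S:]"
    using rhs a2 by (intro key) (auto simp: R2_def)
  from 1 have "alpha0 S = - 0.02178" "beta2 S = 0.56380" "beta0 S = 0.00047"
    by (simp_all add: field_simps)
  moreover from this 2 have "alpha1 S = - 0.97822" "beta1 S = 0.46300"
    by (simp_all add: field_simps)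
  ultimately show "S = O2CP"
    using a2 by (simp add: O2CP_def)
qed

end

theory Submission
  imports Defs
begin

text \<open>
  Write \<open>rho\<close> and \<open>sigma\<close> for the polynomials with the coefficients \<open>alpha\<close> and \<open>beta\<close>. A root
  \<open>z\<close> satisfies \<open>rho z = - mu * sigma z\<close>, so \<open>Re (rho z * cnj (sigma z)) \<le> 0\<close> if \<open>Re mu \<ge> 0\<close>.
  For fixed \<open>cmod z = r\<close> the left-hand side is a quadratic polynomial in \<open>Re z\<close>, concave because
  \<open>alpha0 * beta2 + alpha2 * beta0 \<le> 0\<close>, so it is bounded below by the interpolation between
  its values \<open>rho r * sigma r\<close> and \<open>rho (- r) * sigma (- r)\<close> at the real points of the circle.
  For \<open>O2CP\<close> these are positive if \<open>r \<ge> 1\<close>, except that \<open>rho 1 = 0\<close>. This leaves \<open>z = 1\<close>,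
  which is a root only for \<open>mu = 0\<close>, and then a simple one.
\<close>

text \<open>The factor \<open>2 * r\<close> clears the denominators of the interpolation weights;
  the last term is the interpolation error of a quadratic in \<open>Re z\<close> with leading
  coefficient \<open>2 * (a * f + c * d)\<close>.\<close>

lemma Re_quadratic_mult_cnj_quadratic:
  fixes a b c d e f :: real and z :: complex
  defines "p \<equiv> \<lambda>t. a + b * t + c * t\<^sup>2" and "q \<equiv> \<lambda>t. d + e * t + f * t\<^sup>2" and "r \<equiv> cmod z"
  shows "2 * r * Re ((of_real a + of_real b * z + of_real c * z\<^sup>2)
                     * cnj (of_real d + of_real e * z + of_real f * z\<^sup>2)) =
    (r + Re z) * (p r * q r) + (r - Re z) * (p (- r) * q (- r))
      - 4 * (a * f + c * d) * r * (r\<^sup>2 - (Re z)\<^sup>2)"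
proof -
  obtain x y where z: "z = Complex x y" by (cases z)
  have "r\<^sup>2 = x\<^sup>2 + y\<^sup>2" by (simp add: r_def z cmod_power2)
  then have y2: "y\<^sup>2 = r\<^sup>2 - x\<^sup>2" by simp
  have Re_eq: "Re ((of_real a + of_real b * z + of_real c * z\<^sup>2)
              * cnj (of_real d + of_real e * z + of_real f * z\<^sup>2)) =
    (a + b * x + c * (x\<^sup>2 - y\<^sup>2)) * (d + e * x + f * (x\<^sup>2 - y\<^sup>2))
      + y\<^sup>2 * (b + 2 * c * x) * (e + 2 * f * x)"
    by (simp add: z power2_eq_square algebra_simps)
  have Re_z: "Re z = x" by (simp add: z)
  show ?thesis
    unfolding Re_eq y2 Re_z p_def q_def by algebra
qed

lemma O2CP_Re_pos:
  assumes "cmod z \<ge> 1" "z \<noteq> 1"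
  shows "Re ((of_real (- 0.02178) + of_real (- 0.97822) * z + of_real 1 * z\<^sup>2)
             * cnj (of_real 0.00047 + of_real 0.463 * z + of_real 0.5638 * z\<^sup>2)) > 0"
    (is "?R > 0")
proof -
  define p q :: "real \<Rightarrow> real"
    where "p = (\<lambda>t. - 0.02178 + - 0.97822 * t + 1 * t\<^sup>2)"
      and "q = (\<lambda>t. 0.00047 + 0.463 * t + 0.5638 * t\<^sup>2)"
  define r x where "r = cmod z" and "x = Re z"
  have r: "r \<ge> 1" using assms by (simp add: r_def)
  have x: "\<bar>x\<bar> \<le> r" by (simp add: r_def x_def abs_Re_le_cmod)
  have p_pos: "p r = (r - 1) * (r + 0.02178)" and p_neg: "p (- r) = (r + 1) * (r - 0.02178)"
    by (simp_all add: p_def power2_eq_square field_simps)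
  \<comment> \<open>This makes \<open>q (- r) > 0\<close> linear in \<open>r\<close>, since 0.5638 >
    0.463.\<close>
  have "r \<le> r\<^sup>2" using r by (simp add: power2_eq_square)
  then have q: "q r > 0" "q (- r) > 0" using r by (simp_all add: q_def)
  have A: "p r * q r \<ge> 0" using r q unfolding p_pos by simp
  have B: "p (- r) * q (- r) > 0" using r q unfolding p_neg by simp
  have "(r + x) * (p r * q r) + (r - x) * (p (- r) * q (- r)) > 0"
  proof (cases "x < r")
    case True
    then have "(r - x) * (p (- r) * q (- r)) > 0" using B by simp
    moreover have "(r + x) * (p r * q r) \<ge> 0" using x by (intro mult_nonneg_nonneg [OF _ A]) auto
    ultimately show ?thesis by linarith
  next
    case False
    with x have "x = r" by simp
    \<comment> \<open>Here \<open>z\<close> lies on the positive real axis, so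
      \<open>z \<noteq> 1\<close> forces \<open>r > 1\<close>.\<close>
    then have "Im z = 0" using cmod_power2 [of z] by (simp add: r_def x_def)
    then have "z = of_real r" using \<open>x = r\<close> by (simp add: complex_eq_iff x_def)
    with assms r have "r > 1" by (cases "r = 1") auto
    then have "p r * q r > 0" using q unfolding p_pos by simp
    then show ?thesis using \<open>x = r\<close> r by simp
  qed
  moreover have "x\<^sup>2 \<le> r\<^sup>2" using x by (simp add: abs_le_square_iff [symmetric])
  then have "- 4 * (- 0.02178 * 0.5638 + 1 * 0.00047) * r * (r\<^sup>2 - x\<^sup>2) \<ge> 0"
    using r by simp
  ultimately have "2 * r * ?R > 0"
    using Re_quadratic_mult_cnj_quadratic
      [where z = z and a = "- 0.02178" and b = "- 0.97822" and c = 1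
         and d = "0.00047" and e = "0.463" and f = "0.5638"]
    unfolding p_def q_def r_def x_def by linarith
  then show ?thesis using r by (simp add: zero_less_mult_iff)
qed

lemma O2CP_root:
  assumes "Re mu \<ge> 0" "poly (char_poly O2CP mu) z = 0" "cmod z \<ge> 1"
  shows "z = 1" "mu = 0"
proof -
  let ?rho = "of_real (- 0.02178) + of_real (- 0.97822) * z + of_real 1 * z\<^sup>2"
  let ?sigma = "of_real 0.00047 + of_real 0.463 * z + of_real 0.5638 * z\<^sup>2"
  have eq: "?rho = - mu * ?sigma"
    using assms(2) by (simp add: char_poly_def O2CP_def) algebra
  have "?rho * cnj ?sigma = - mu * of_real ((cmod ?sigma)\<^sup>2)"
    unfolding eq complex_norm_square by (simp only: mult.assoc)
  then have "Re (?rho * cnj ?sigma) = - (Re mu * (cmod ?sigma)\<^sup>2)"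
    by (simp only: Re_complex_of_real Im_complex_of_real times_complex.simps uminus_complex.simps)
  then have "Re (?rho * cnj ?sigma) \<le> 0" using assms(1) by simp
  then show z: "z = 1" using O2CP_Re_pos [of z] assms(3) by linarith
  \<comment> \<open>At 1 the left side vanishes, while \<open>?sigma\<close> is 1.02727.\<close>
  show "mu = 0" using eq unfolding z by simp
qed

theorem proposition6:
  shows "A_stable O2CP \<and> consistent O2CP"
proof
  show "A_stable O2CP"
    unfolding A_stable_def
  proof (intro allI impI)
    fix mu z
    assume *: "Re mu \<ge> 0" "poly (char_poly O2CP mu) z = 0"
    show "cmod z \<le> 1 \<and> (order z (char_poly O2CP mu) \<ge> 2 \<longrightarrow> cmod z < 1)"
    proof (cases "cmod z \<ge> 1")
      case True
      note root = O2CP_root [OF * True]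
      \<comment> \<open>A double root would annihilate the derivative, whose value at 1 is 2 -
        0.97822.\<close>
      have "\<not> [:- 1, 1:] ^ 2 dvd char_poly O2CP 0"
      proof
        assume "[:- 1, 1:] ^ 2 dvd char_poly O2CP 0"
        then obtain s where "char_poly O2CP 0 = [:- 1, 1:] ^ 2 * s" by (elim dvdE)
        then have "poly (pderiv (char_poly O2CP 0)) 1 = 0"
          by (simp only: pderiv_mult power2_eq_square poly_add poly_mult) simp
        then show False by (simp add: char_poly_def O2CP_def pderiv_pCons)
      qed
      moreover have "char_poly O2CP 0 \<noteq> 0" by (simp add: char_poly_def O2CP_def)
      ultimately have "\<not> order 1 (char_poly O2CP 0) \<ge> 2" by (simp add: order_divides)
      then show ?thesis using root by simp
    qed auto
  qed
  show "consistent O2CP"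
    by (simp add: consistent_def O2CP_def)
qed

end
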